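(* Let $(R,\mathfrak{m})$ be a finite commutative local ring with identity, of odd characteristic, with $R/\mathfrak{m}\simeq\mathbb{F}_q$, and let $k\in\mathbb{N}$. Then $G_R(k)$ is undirected if and only if $G_{R/\mathfrak{m}}(k)$ is undirected (equivalently, $G_R(k)$ is directed if and only if $G_{R/\mathfrak{m}}(k)$ is directed).
   Context: For a commutative ring $R$ with identity and $k\in\mathbb{N}$ (positive integer), $R^*$ is the group of units and $U_{R,k}=\{x^k:x\in R^*\}$. For an abelian group $A$ and $S\subseteq A$ with $0\notin S$, $X(A,S)$ denotes the Cayley digraph with vertex set $A$ and an arc from $v$ to $w$ iff $w-v\in S$. It is called undirected if $S=-S$ and directed otherwise. The $k$-th unitary Cayley graph is $G_R(k)=X(R,U_{R,k})$. *)

theory Defs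
  imports "HOL-Algebra.Algebra" "Graph_Theory.Pair_Digraph"
begin

text \<open>
  Abelian groups are written multiplicatively in \<^theory>\<open>HOL-Algebra.Group\<close>; the
  additive group of a ring R is \<^term>\<open>add_monoid R\<close>.  The difference w - v is therefore
  w \<open>\<otimes>\<close> inv v, the neutral element 0 is \<open>\<one>\<close>, and -S is \<open>set_inv S\<close>.
\<close>

definition cayley_digraph :: "('a, 'b) monoid_scheme \<Rightarrow> 'a set \<Rightarrow> 'a pair_pre_digraph" where
  "cayley_digraph A S =
     \<lparr> pverts = carrier A,
       parcs = {(v, w). v \<in> carrier A \<and> w \<in> carrier A \<and> w \<otimes>\<^bsub>A\<^esub> inv\<^bsub>A\<^esub> v \<in> S} \<rparr>"

text \<open>
  Being undirected or directed is a property of the connection set S of a Cayley digraph.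
  The existential quantifiers recover S from the digraph: S is uniquely determined by
  it, as it is the set of out-neighbours of the neutral element.
\<close>

definition cayley_undirected :: "('a, 'b) monoid_scheme \<Rightarrow> 'a pair_pre_digraph \<Rightarrow> bool" where
  "cayley_undirected A D \<longleftrightarrow>
     (\<exists>S \<subseteq> carrier A. \<one>\<^bsub>A\<^esub> \<notin> S \<and> D = cayley_digraph A S \<and> S = set_inv\<^bsub>A\<^esub> S)"

definition cayley_directed :: "('a, 'b) monoid_scheme \<Rightarrow> 'a pair_pre_digraph \<Rightarrow> bool" where
  "cayley_directed A D \<longleftrightarrow>
     (\<exists>S \<subseteq> carrier A. \<one>\<^bsub>A\<^esub> \<notin> S \<and> D = cayley_digraph A S \<and> S \<noteq> set_inv\<^bsub>A\<^esub> S)"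

lemma (in group) cayley_digraph_inj:
  assumes "S \<subseteq> carrier G" "T \<subseteq> carrier G" "cayley_digraph G S = cayley_digraph G T"
  shows "S = T"
proof -
  have "S' = {w. (\<one>, w) \<in> parcs (cayley_digraph G S')}" if "S' \<subseteq> carrier G" for S'
    using that by (auto simp: cayley_digraph_def)
  then show ?thesis
    using assms by metis
qed

lemma (in group) cayley_undirected_iff:
  assumes "S \<subseteq> carrier G" "\<one> \<notin> S"
  shows "cayley_undirected G (cayley_digraph G S) \<longleftrightarrow> S = set_inv S"
  unfolding cayley_undirected_def using assms cayley_digraph_inj by metis

lemma (in group) cayley_directed_iff:
  assumes "S \<subseteq> carrier G" "\<one> \<notin> S"
  shows "cayley_directed G (cayley_digraph G S) \<longleftrightarrow> S \<noteq> set_inv S"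
  unfolding cayley_directed_def using assms cayley_digraph_inj by metis

definition unit_powers :: "('a, 'b) ring_scheme \<Rightarrow> nat \<Rightarrow> 'a set" where
  "unit_powers R k = {x [^]\<^bsub>R\<^esub> k | x. x \<in> Units R}"

definition unitary_cayley_graph :: "('a, 'b) ring_scheme \<Rightarrow> nat \<Rightarrow> 'a pair_pre_digraph" where
  "unitary_cayley_graph R k = cayley_digraph (add_monoid R) (unit_powers R k)"

lemma (in ring) zero_notin_unit_powers:
  assumes "\<one> \<noteq> \<zero>"
  shows "\<zero> \<notin> unit_powers R k"
proof
  assume "\<zero> \<in> unit_powers R k"
  then obtain x where x: "x \<in> Units R" "\<zero> = x [^] k"
    unfolding unit_powers_def by blast
  then have "\<zero> \<in> Units R"
    using Units_pow_closed by metis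
  then show False
    using assms Units_r_inv Units_inv_closed l_null by metis
qed

locale local_ring = cring R + maximalideal \<mm> R for R (structure) and \<mm> +
  assumes maximalideal_unique: "maximalideal J R \<Longrightarrow> J = \<mm>"

text \<open>As usual, the value is 0 if no positive multiple of the identity vanishes.\<close>

definition ring_characteristic :: "('a, 'b) ring_scheme \<Rightarrow> nat" where
  "ring_characteristic R = group.ord (add_monoid R) \<one>\<^bsub>R\<^esub>"

end

theory Submission
  imports Defs
begin

text \<open>
  The set of \<open>k\<close>-th powers of units is a multiplicative group, so it is symmetric exactly
  when it contains \<open>-1\<close> (lemma \<open>unit_powers_symmetric_iff\<close>).  Hence the theorem says that
  \<open>-1\<close> is a \<open>k\<close>-th power of a unit in \<open>R\<close> iff it is one in \<open>R/\<mm>\<close>.  A \<open>k\<close>-th root of \<open>-1\<close> can be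
  reduced modulo \<open>\<mm>\<close>.  Conversely, a root of \<open>-1\<close> modulo \<open>\<mm>\<close> lifts to a unit \<open>x\<close> of \<open>R\<close> with
  \<open>-1 = x\<^sup>k u\<close> for some \<open>u \<in> 1 + \<mm>\<close>.  The principal units \<open>1 + \<mm>\<close> form a group of order
  \<open>n = |\<mm>|\<close>, and \<open>n\<close> divides \<open>|R|\<close>, which is odd because the characteristic is.  Raising the
  equation to the \<open>n\<close>-th power kills \<open>u\<close> and preserves \<open>-1\<close>, so that \<open>-1 = (x\<^sup>n)\<^sup>k\<close>
  (lemma \<open>minus_one_unit_power_Quot_iff\<close>).
\<close>

section \<open>Groups and rings of odd order\<close>

text \<open>
  By Cauchy's theorem, here in the form of a Sylow subgroup of order \<open>2\<close>, a group of even
  order has an involution.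
\<close>

lemma (in group) odd_order_if_odd_ords:
  assumes fin: "finite (carrier G)" and ords: "\<And>x. x \<in> carrier G \<Longrightarrow> odd (ord x)"
  shows "odd (order G)"
proof
  assume "even (order G)"
  then obtain m where "order G = 2 ^ 1 * m"
    by (auto elim: evenE)
  then obtain H where H: "subgroup H G" "card H = 2"
    using sylow_thm[of 2 G 1 m] fin is_group by auto
  interpret H: group "G\<lparr>carrier := H\<rparr>"
    using H(1) subgroup.subgroup_is_group is_group by blast
  have "H \<noteq> {\<one>}"
    using H(2) by auto
  then obtain x where x: "x \<in> H" "x \<noteq> \<one>"
    using subgroup.one_closed[OF H(1)] by blast
  have xG: "x \<in> carrier G"
    using subgroup.mem_carrier[OF H(1) x(1)] .
  have "x [^] (2::nat) = \<one>"
    using H.pow_order_eq_1[of x] x(1) H(2) nat_pow_consistent[of x 2 H]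
    by (simp add: order_def)
  then have "ord x dvd 2"
    using pow_eq_id[OF xG] by blast
  then have "ord x = 1"
    using ords[OF xG] prime_nat_iff[of 2] two_is_prime_nat by fastforce
  then show False
    using ord_eq_1[OF xG] x(2) by blast
qed

text \<open>The characteristic annihilates \<open>R\<close>, so it is a multiple of every additive order.\<close>

lemma (in ring) odd_order_if_odd_characteristic:
  assumes fin: "finite (carrier R)" and odd_char: "odd (ring_characteristic R)"
  shows "odd (order R)"
proof -
  let ?c = "ring_characteristic R"
  have "odd (group.ord (add_monoid R) x)" if x: "x \<in> carrier R" for x
  proof -
    have "[?c] \<cdot> \<one> = \<zero>"
      using add.pow_ord_eq_1[of \<one>] by (simp add: ring_characteristic_def add_pow_def)
    then have "[?c] \<cdot> x = \<zero>"
      using add_pow_ldistr[of \<one> x ?c] x by simp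
    then have "group.ord (add_monoid R) x dvd ?c"
      using add.pow_eq_id[of x ?c] x by (simp add: add_pow_def)
    then show ?thesis
      using odd_char dvd_trans by blast
  qed
  then show ?thesis
    using add.odd_order_if_odd_ords fin by (simp add: order_def)
qed

lemma (in ideal) card_dvd_order: "card I dvd order R"
  using add.lagrange[OF a_subgroup] by (metis dvd_triv_right order_def partial_object.select_convs(1))

section \<open>Units of a finite local ring\<close>

lemma (in ring) proper_ideal_in_maximalideal_if_finite:
  assumes fin: "finite (carrier R)" and I: "ideal I R" "I \<noteq> carrier R"
  obtains M where "maximalideal M R" "I \<subseteq> M"
proof -
  let ?\<I> = "{J. ideal J R \<and> J \<noteq> carrier R}"
  have sub: "J \<subseteq> carrier R" if "ideal J R" for J
    using ideal.Icarr[OF that] by blast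
  have "finite ?\<I>"
    by (rule finite_subset[of _ "Pow (carrier R)"]) (use sub fin in auto)
  then obtain M where M: "M \<in> ?\<I>" "I \<subseteq> M" "\<And>J. J \<in> ?\<I> \<Longrightarrow> M \<subseteq> J \<Longrightarrow> M = J"
    using finite_has_maximal2[of ?\<I> I] I by auto
  then have "maximalideal M R"
    by (intro maximalidealI) blast+
  then show ?thesis
    using that M(2) by blast
qed

text \<open>
  A non-unit generates a proper ideal, which lies in some maximal ideal; the only candidate
  is \<open>\<mm>\<close>.
\<close>

lemma (in local_ring) nonmember_Units_if_finite:
  assumes fin: "finite (carrier R)" and a: "a \<in> carrier R" "a \<notin> \<mm>"
  shows "a \<in> Units R"
proof (rule ccontr)
  assume nonunit: "a \<notin> Units R"
  have "\<one> \<notin> PIdl a"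
  proof
    assume "\<one> \<in> PIdl a"
    then obtain b where "b \<in> carrier R" "\<one> = b \<otimes> a"
      unfolding cgenideal_def by blast
    then show False
      using nonunit a(1) m_comm unfolding Units_def by auto
  qed
  then have "PIdl a \<noteq> carrier R"
    by auto
  then obtain M where "maximalideal M R" "PIdl a \<subseteq> M"
    using proper_ideal_in_maximalideal_if_finite[OF fin cgenideal_ideal[OF a(1)]] by blast
  then show False
    using maximalideal_unique cgenideal_self[OF a(1)] a(2) by blast
qed

lemma (in local_ring) one_notin: "\<one> \<notin> \<mm>"
  using one_imp_carrier I_notcarr by blast

text \<open>The principal units are the kernel of reduction modulo \<open>\<mm>\<close> on the group of units.\<close>

lemma (in local_ring) principal_units_subgroup:
  assumes fin: "finite (carrier R)"
  shows "subgroup (\<mm> +> \<one>) (units_of R)"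
proof -
  interpret Q: ring_hom_ring R "R Quot \<mm>" "(+>) \<mm>"
    by (rule rcos_ring_hom_ring)
  have mem_iff: "u \<in> \<mm> +> \<one> \<longleftrightarrow> u \<in> carrier R \<and> \<mm> +> u = \<mm> +> \<one>" for u
    using a_rcos_self[of u] a_repr_independence'[of u \<one>] a_elemrcos_carrier[of \<one> u] by auto
  have unit: "u \<in> Units R" if "u \<in> \<mm> +> \<one>" for u
  proof (rule nonmember_Units_if_finite[OF fin])
    show "u \<in> carrier R"
      using that mem_iff by blast
    show "u \<notin> \<mm>"
    proof
      assume "u \<in> \<mm>"
      then have "\<mm> +> \<one> = \<mm>"
        using that mem_iff a_rcos_const by metis
      then show False
        using one_notin rcos_const_imp_mem by blast
    qed
  qed
  show ?thesis
  proof (rule group.subgroupI[OF units_group])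
    show "\<mm> +> \<one> \<subseteq> carrier (units_of R)"
      using unit by (auto simp: units_of_carrier)
    show "\<mm> +> \<one> \<noteq> {}"
      using mem_iff[of \<one>] by auto
    show "inv\<^bsub>units_of R\<^esub> u \<in> \<mm> +> \<one>" if u: "u \<in> \<mm> +> \<one>" for u
    proof -
      have "\<mm> +> inv u = (\<mm> +> u) \<otimes>\<^bsub>R Quot \<mm>\<^esub> (\<mm> +> inv u)"
        using u unit mem_iff Q.hom_one by simp
      also have "\<dots> = \<mm> +> \<one>"
        using unit[OF u] Q.hom_mult[of u "inv u"] by (simp add: Units_closed)
      finally show ?thesis
        using mem_iff unit[OF u] by (simp add: units_of_inv)
    qed
    show "u \<otimes>\<^bsub>units_of R\<^esub> v \<in> \<mm> +> \<one>" if "u \<in> \<mm> +> \<one>" "v \<in> \<mm> +> \<one>" for u v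
      using that mem_iff by (simp add: units_of_mult)
  qed
qed

lemma (in local_ring) principal_unit_pow_card:
  assumes fin: "finite (carrier R)" and u: "u \<in> \<mm> +> \<one>"
  shows "u [^] card \<mm> = \<one>"
proof -
  interpret U: group "units_of R"
    by (rule units_group)
  let ?H = "units_of R\<lparr>carrier := \<mm> +> \<one>\<rparr>"
  have sub: "subgroup (\<mm> +> \<one>) (units_of R)"
    by (rule principal_units_subgroup[OF fin])
  have "\<mm> +> \<one> \<in> a_rcosets \<mm>"
    using a_rcosetsI a_subset by blast
  then have "order ?H = card \<mm>"
    using add.card_rcosets_equal[of _ \<mm>] a_subset by (simp add: order_def A_RCOSETS_def)
  moreover have "u [^]\<^bsub>?H\<^esub> order ?H = \<one>\<^bsub>?H\<^esub>"
    using group.pow_order_eq_1[of ?H u] subgroup.subgroup_is_group[OF sub U.is_group] u by simp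
  ultimately show ?thesis
    using u subgroup.mem_carrier[OF sub u] U.nat_pow_consistent[of u "card \<mm>" "\<mm> +> \<one>"]
    by (simp add: units_of_pow units_of_carrier units_of_one)
qed

section \<open>Symmetry of the set of unit powers\<close>

lemma (in ring) unit_powers_closed: "unit_powers R k \<subseteq> carrier R"
  unfolding unit_powers_def by auto

lemma (in cring) unit_powers_symmetric_iff:
  "unit_powers R k = set_inv\<^bsub>add_monoid R\<^esub> (unit_powers R k) \<longleftrightarrow> \<ominus> \<one> \<in> unit_powers R k"
  (is "?U = ?N \<longleftrightarrow> _")
proof
  have N: "?N = {\<ominus> x | x. x \<in> ?U}"
    unfolding SET_INV_def a_inv_def by blast
  have one: "\<one> \<in> ?U"
    unfolding unit_powers_def using Units_one_closed nat_pow_one[of k] by force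
  show "\<ominus> \<one> \<in> ?U" if "?U = ?N"
  proof -
    have "\<ominus> \<one> \<in> ?N"
      unfolding N using one by blast
    then show ?thesis
      by (subst that)
  qed
  show "?U = ?N" if neg: "\<ominus> \<one> \<in> ?U"
  proof -
    have closed: "\<ominus> x \<in> ?U" if x: "x \<in> ?U" for x
    proof -
      from neg obtain y where y: "y \<in> Units R" "\<ominus> \<one> = y [^] k"
        unfolding unit_powers_def by blast
      from x obtain z where z: "z \<in> Units R" "x = z [^] k"
        unfolding unit_powers_def by blast
      have "\<ominus> x = \<ominus> \<one> \<otimes> x"
        using subsetD[OF unit_powers_closed x] by (simp add: l_minus)
      also have "\<dots> = y [^] k \<otimes> z [^] k"
        by (simp only: y(2) z(2))
      also have "\<dots> = (y \<otimes> z) [^] k"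
        by (rule nat_pow_distrib[symmetric]) (use y(1) z(1) Units_closed in auto)
      finally show ?thesis
        using Units_m_closed[OF y(1) z(1)] unfolding unit_powers_def by blast
    qed
    show ?thesis
      unfolding N
    proof (intro subset_antisym subsetI)
      fix x assume x: "x \<in> ?U"
      then have "x = \<ominus> (\<ominus> x)"
        using minus_minus unit_powers_closed by (simp add: subset_iff)
      with closed[OF x] show "x \<in> {\<ominus> x | x. x \<in> ?U}"
        by (intro CollectI exI[of _ "\<ominus> x"] conjI)
    next
      fix x assume "x \<in> {\<ominus> x | x. x \<in> ?U}"
      then obtain z where "x = \<ominus> z" "z \<in> ?U"
        by (elim CollectE exE conjE)
      then show "x \<in> ?U"
        by (simp only: closed)
    qed
  qed
qed

lemma (in cring) unitary_cayley_graph_undirected_iff: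
  assumes "\<one> \<noteq> \<zero>"
  shows "cayley_undirected (add_monoid R) (unitary_cayley_graph R k) \<longleftrightarrow> \<ominus> \<one> \<in> unit_powers R k"
  using add.cayley_undirected_iff[of "unit_powers R k"] unit_powers_closed
    zero_notin_unit_powers[OF assms] unit_powers_symmetric_iff
  by (simp add: unitary_cayley_graph_def)

lemma (in cring) unitary_cayley_graph_directed_iff:
  assumes "\<one> \<noteq> \<zero>"
  shows "cayley_directed (add_monoid R) (unitary_cayley_graph R k) \<longleftrightarrow> \<ominus> \<one> \<notin> unit_powers R k"
  using add.cayley_directed_iff[of "unit_powers R k"] unit_powers_closed
    zero_notin_unit_powers[OF assms] unit_powers_symmetric_iff
  by (simp add: unitary_cayley_graph_def)

section \<open>Lifting roots of \<open>-1\<close> from the residue field\<close>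

lemma (in ring) minus_one_pow_odd:
  assumes "odd n"
  shows "(\<ominus> \<one>) [^] (n::nat) = \<ominus> \<one>"
proof -
  from assms obtain m where m: "n = 2 * m + 1"
    by (auto elim: oddE)
  have "(\<ominus> \<one>) [^] (2::nat) = \<one>"
    by (simp add: numeral_2_eq_2 l_minus)
  then have "(\<ominus> \<one>) [^] (2 * m) = \<one>"
    by (metis add.inv_closed nat_pow_one nat_pow_pow one_closed)
  then show ?thesis
    by (simp add: m)
qed

lemma (in ring_hom_ring) hom_Units:
  assumes "x \<in> Units R"
  shows "h x \<in> Units S"
proof -
  have "h x \<otimes>\<^bsub>S\<^esub> h (inv x) = \<one>\<^bsub>S\<^esub>" "h (inv x) \<otimes>\<^bsub>S\<^esub> h x = \<one>\<^bsub>S\<^esub>"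
    using assms hom_mult[of x "inv x"] hom_mult[of "inv x" x] hom_one by (simp_all add: R.Units_closed)
  then show ?thesis
    using assms unfolding Units_def[of S] by (auto intro!: bexI[of _ "h (inv x)"])
qed

text \<open>
  From right to left a root is reduced modulo \<open>\<mm>\<close>.  From left to right an arbitrary lift \<open>x\<close>
  of the root misses \<open>-1\<close> only by a principal unit, and \<open>x\<^bsup>|\<mm>|\<^esup>\<close> is then an exact root.
\<close>

lemma (in local_ring) minus_one_unit_power_Quot_iff:
  assumes fin: "finite (carrier R)" and odd_card: "odd (card \<mm>)"
  shows "\<ominus>\<^bsub>R Quot \<mm>\<^esub> \<one>\<^bsub>R Quot \<mm>\<^esub> \<in> unit_powers (R Quot \<mm>) k \<longleftrightarrow> \<ominus> \<one> \<in> unit_powers R k"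
    (is "?Q \<longleftrightarrow> ?R")
proof
  interpret Q: ring_hom_ring R "R Quot \<mm>" "(+>) \<mm>"
    by (rule rcos_ring_hom_ring)
  interpret D: domain "R Quot \<mm>"
    by (rule primeideal.quotient_is_domain[OF maximalideal_prime[OF is_maximalideal]])
  have minus_one: "\<ominus>\<^bsub>R Quot \<mm>\<^esub> \<one>\<^bsub>R Quot \<mm>\<^esub> = \<mm> +> \<ominus> \<one>"
    by simp
  show ?Q if ?R
  proof -
    from that obtain x where "x \<in> Units R" "\<ominus> \<one> = x [^] k"
      unfolding unit_powers_def by blast
    then show ?thesis
      unfolding minus_one unit_powers_def using Q.hom_Units[of x] Q.hom_nat_pow[of x k] by auto
  qed
  show ?R if ?Q
  proof -
    from that obtain y where y: "y \<in> Units (R Quot \<mm>)" "\<mm> +> \<ominus> \<one> = y [^]\<^bsub>R Quot \<mm>\<^esub> k"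
      unfolding minus_one unit_powers_def by blast
    then obtain x where x: "x \<in> carrier R" "y = \<mm> +> x"
      using Q.S.Units_closed[OF y(1)] unfolding FactRing_def A_RCOSETS_def' partial_object.simps by blast
    have "x \<notin> \<mm>"
    proof
      assume "x \<in> \<mm>"
      then have y0: "y = \<zero>\<^bsub>R Quot \<mm>\<^esub>"
        unfolding x(2) FactRing_def ring.simps by (rule a_rcos_const)
      have "\<one>\<^bsub>R Quot \<mm>\<^esub> = y \<otimes>\<^bsub>R Quot \<mm>\<^esub> inv\<^bsub>R Quot \<mm>\<^esub> y"
        by (rule Q.S.Units_r_inv[OF y(1), symmetric])
      also have "\<dots> = \<zero>\<^bsub>R Quot \<mm>\<^esub> \<otimes>\<^bsub>R Quot \<mm>\<^esub> inv\<^bsub>R Quot \<mm>\<^esub> y"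
        by (simp only: y0)
      also have "\<dots> = \<zero>\<^bsub>R Quot \<mm>\<^esub>"
        by (rule Q.S.l_null[OF Q.S.Units_inv_closed[OF y(1)]])
      finally show False
        by (rule notE[OF D.one_not_zero])
    qed
    then have xU: "x \<in> Units R"
      using nonmember_Units_if_finite[OF fin x(1)] by blast
    \<comment> \<open>The principal unit by which \<open>x\<^sup>k\<close> fails to be \<open>-1\<close>.\<close>
    define u where "u = \<ominus> \<one> \<otimes> inv (x [^] k)"
    have xkU: "x [^] k \<in> Units R"
      using xU by (rule Units_pow_closed)
    have u: "u \<in> carrier R" "\<ominus> \<one> = u \<otimes> x [^] k"
      unfolding u_def using xkU by (simp_all add: m_assoc Units_closed)
    have "\<mm> +> u = (\<mm> +> \<ominus> \<one>) \<otimes>\<^bsub>R Quot \<mm>\<^esub> (\<mm> +> inv (x [^] k))"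
      unfolding u_def using xkU by (intro Q.hom_mult) simp_all
    also have "\<mm> +> \<ominus> \<one> = \<mm> +> x [^] k"
      using y(2) x(2) Q.hom_nat_pow[OF x(1)] by metis
    also have "(\<mm> +> x [^] k) \<otimes>\<^bsub>R Quot \<mm>\<^esub> (\<mm> +> inv (x [^] k)) = \<mm> +> \<one>"
      using xkU Q.hom_mult[of "x [^] k" "inv (x [^] k)"] Units_closed Units_inv_closed Units_r_inv
      by metis
    finally have "u \<in> \<mm> +> \<one>"
      using a_rcos_self[OF u(1)] by simp
    then have u_pow: "u [^] card \<mm> = \<one>"
      by (rule principal_unit_pow_card[OF fin])
    have "\<ominus> \<one> = (\<ominus> \<one>) [^] card \<mm>"
      using minus_one_pow_odd[OF odd_card] by simp
    also have "\<dots> = (u \<otimes> x [^] k) [^] card \<mm>"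
      by (simp only: u(2))
    also have "\<dots> = (x [^] k) [^] card \<mm>"
      using nat_pow_distrib[OF u(1) nat_pow_closed[OF x(1)]] u_pow x(1) by simp
    also have "\<dots> = (x [^] card \<mm>) [^] k"
      using nat_pow_pow[OF x(1)] by (simp add: mult.commute)
    finally show ?thesis
      using Units_pow_closed[OF xU] unfolding unit_powers_def
      by (intro CollectI exI[of _ "x [^] card \<mm>"] conjI)
  qed
qed

theorem proposition3p2:
  fixes R :: "('a, 'r) ring_scheme"
    and \<mm> :: "'a set"
    and F :: "('f, 's) ring_scheme"
    and q k :: nat
  assumes "local_ring R \<mm>"
    and "finite (carrier R)"
    and "odd (ring_characteristic R)"
    and "field F" and "finite (carrier F)" and "order F = q"
    and "R Quot \<mm> \<simeq> F"
    and "k \<ge> 1"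
  shows "(cayley_undirected (add_monoid R) (unitary_cayley_graph R k)
           \<longleftrightarrow> cayley_undirected (add_monoid (R Quot \<mm>)) (unitary_cayley_graph (R Quot \<mm>) k))
       \<and> (cayley_directed (add_monoid R) (unitary_cayley_graph R k)
           \<longleftrightarrow> cayley_directed (add_monoid (R Quot \<mm>)) (unitary_cayley_graph (R Quot \<mm>) k))"
proof -
  interpret local_ring R \<mm>
    by fact
  interpret D: domain "R Quot \<mm>"
    by (rule primeideal.quotient_is_domain[OF maximalideal_prime[OF is_maximalideal]])
  have "odd (card \<mm>)"
    using odd_order_if_odd_characteristic[OF assms(2,3)] card_dvd_order dvd_trans by blast
  moreover have "\<one>\<^bsub>R\<^esub> \<noteq> \<zero>\<^bsub>R\<^esub>"
    using one_notin additive_subgroup.zero_closed[OF is_additive_subgroup] by metis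
  ultimately show ?thesis
    using minus_one_unit_power_Quot_iff[OF assms(2)] D.one_not_zero
      unitary_cayley_graph_undirected_iff unitary_cayley_graph_directed_iff
      D.unitary_cayley_graph_undirected_iff D.unitary_cayley_graph_directed_iff
    by blast
qed

end
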